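(* The function $$z\mapsto g_{\nu}(z)=2^{\nu}\Gamma(\nu+1)z^{1-\nu}J_{\nu}(z)$$ is starlike of order $\alpha\in[0,1)$ in $\mathbb{D}$ if and only if $\nu>\nu_2(\alpha)$, where $\nu_2(\alpha)$ is the unique root of the equation (in the unknown $\nu$) $$(1-\alpha)J_{\nu}(1)=J_{\nu+1}(1),$$ situated in $(\tilde{\nu},\infty)$, where $\tilde{\nu}\simeq-0.7745\dots$ is the unique root of $j_{\nu,1}=1$ and $j_{\nu,1}$ is the first positive zero of $J_{\nu}$. In particular, the function $g_{\nu}$ is starlike in $\mathbb{D}$ if and only if $\nu>\nu_2(0)$, where $\nu_2(0)\simeq-0.3397\dots$ is the unique root of the transcendental equation $J_{\nu}(1)=J_{\nu+1}(1)$.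
   Context: $\mathbb{D}=\{z\in\mathbb{C}:|z|<1\}$ is the open unit disk. $J_\nu$ is the Bessel function of the first kind of order $\nu$, $J_\nu(z)=\sum_{n\ge0}\frac{(-1)^n}{n!\,\Gamma(n+\nu+1)}\left(\frac z2\right)^{2n+\nu}$, and $\Gamma$ is the Euler gamma function. The function $g_\nu$ is understood as the function given by the resulting power series, with $g_\nu(0)=0$, $g_\nu'(0)=1$. An analytic function $f$ on $\mathbb{D}$ with $f(0)=0$, $f'(0)=1$ is starlike of order $\alpha\in[0,1)$ in $\mathbb{D}$ if $\operatorname{Re}\left(zf'(z)/f(z)\right)>\alpha$ for all $z\in\mathbb{D}$; starlike means starlike of order $0$.
   Formalization: Stated for ν > -1 (below, j_{ν,1}=1 has other roots and the equivalence fails, e.g. ν=-10.5); "ν > ν_2(α)" becomes "ν ≥ ν_2(α)", also for α=0, since g_ν is still starlike of order α at ν=ν_2(α); ν_2(0) is about -0.3401, so -0.3397 is given only within 0.0005. *)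

theory Defs
  imports "HOL-Complex_Analysis.Complex_Analysis"
begin

(* Complex powers are principal branches. Isabelle has 0 powr s = 0 for every s, so the value at
   z = 0 is meaningful only for nu > 0; bessel_J is used below at nonzero arguments only. *)
definition bessel_J :: "real \<Rightarrow> complex \<Rightarrow> complex" where
  "bessel_J \<nu> z =
     (\<Sum>n. (-1) ^ n / (fact n * Gamma (of_nat n + of_real \<nu> + 1))
            * (z / 2) powr (2 * of_nat n + of_real \<nu>))"

(* The branch cuts of the two powers cancel, and the value 0 at the origin is the one
   given by the power series: see bessel_g_power_series below. *)
definition bessel_g :: "real \<Rightarrow> complex \<Rightarrow> complex" where
  "bessel_g \<nu> z =
     (if z = 0 then 0
      else 2 powr (of_real \<nu>) * Gamma (of_real \<nu> + 1) * z powr (1 - of_real \<nu>) * bessel_J \<nu> z)"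

(* The equation j_{nu,1} = x, as a relation: it includes the existence of the zero. *)
definition first_positive_zero_J :: "real \<Rightarrow> real \<Rightarrow> bool" where
  "first_positive_zero_J \<nu> x \<longleftrightarrow>
     x > 0 \<and> bessel_J \<nu> (of_real x) = 0 \<and> (\<forall>y. 0 < y \<and> y < x \<longrightarrow> bessel_J \<nu> (of_real y) \<noteq> 0)"

(* At z = 0 the quotient z f'(z) / f(z) has a removable singularity with value 1, whereas
   Isabelle's 0 / 0 is 0; hence the origin is left out. *)
definition starlike_of_order :: "real \<Rightarrow> (complex \<Rightarrow> complex) \<Rightarrow> bool" where
  "starlike_of_order \<alpha> f \<longleftrightarrow>
     f holomorphic_on ball 0 1 \<and> f 0 = 0 \<and> deriv f 0 = 1 \<and>
     (\<forall>z \<in> ball 0 1 - {0}. f z \<noteq> 0 \<and> Re (z * deriv f z / f z) > \<alpha>)"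

abbreviation starlike_on_disk :: "(complex \<Rightarrow> complex) \<Rightarrow> bool" where
  "starlike_on_disk f \<equiv> starlike_of_order 0 f"

(* Only nu > -1 is admitted: below -1 there are further parameters with j_{nu,1} = 1. *)
definition nu_tilde :: real where
  "nu_tilde = (THE \<nu>. \<nu> > -1 \<and> first_positive_zero_J \<nu> 1)"

(* At nu = nu2 alpha the infimum alpha of Re (z g'(z) / g(z)) over the disk is approached only as
   z tends to 1 or -1, so g is still starlike of order alpha on the open disk: the parameters
   nu > -1 with this property form the closed half-line starting at nu2 alpha. *)
definition nu2 :: "real \<Rightarrow> real" where
  "nu2 \<alpha> = (THE \<nu>. \<nu> > nu_tilde \<and> (1 - of_real \<alpha>) * bessel_J \<nu> 1 = bessel_J (\<nu> + 1) 1)"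

lemma shifted_not_nonpos_Int:
  assumes "\<nu> > -1"
  shows "of_nat n + of_real \<nu> + 1 \<notin> (\<int>\<^sub>\<le>\<^sub>0 :: complex set)"
proof
  assume "of_nat n + of_real \<nu> + 1 \<in> (\<int>\<^sub>\<le>\<^sub>0 :: complex set)"
  then obtain k where "of_nat n + of_real \<nu> + 1 = (- of_nat k :: complex)"
    by (auto elim: nonpos_Ints_cases')
  hence "Re (of_nat n + of_real \<nu> + 1) = Re (- of_nat k)" by presburger
  thus False using assms by simp
qed

lemma bessel_series_summable:
  fixes z :: complex
  assumes "\<nu> > -1"
  shows "summable (\<lambda>n. (-1) ^ n * Gamma (of_real \<nu> + 1) / (4 ^ n * fact n * Gamma (of_nat n + of_real \<nu> + 1))
                        * z ^ (2 * n + 1))"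
    (is "summable ?a")
proof -
  define N where "N = nat \<lceil>(norm z)\<^sup>2 + \<bar>\<nu>\<bar>\<rceil>"
  have "norm (?a (Suc n)) \<le> 1 / 2 * norm (?a n)" if "n \<ge> N" for n
  proof -
    have np: "of_nat n + of_real \<nu> + 1 \<notin> (\<int>\<^sub>\<le>\<^sub>0 :: complex set)"
      by (rule shifted_not_nonpos_Int[OF assms])
    have nz: "of_nat n + of_real \<nu> + 1 \<noteq> (0::complex)"
      using np by auto
    have G: "Gamma (of_nat (Suc n) + of_real \<nu> + 1)
             = (of_nat n + of_real \<nu> + 1) * Gamma (of_nat n + of_real \<nu> + 1 :: complex)"
      using Gamma_plus1[OF np] by (simp add: add_ac)
    have eq: "?a (Suc n) = - (z\<^sup>2 / (4 * of_nat (Suc n) * (of_nat n + of_real \<nu> + 1))) * ?a n"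
      unfolding G fact_Suc by (simp add: power2_eq_square mult_ac del: of_nat_Suc)
    have n: "real n \<ge> (norm z)\<^sup>2 + \<bar>\<nu>\<bar>" using that unfolding N_def by linarith
    have "norm (z\<^sup>2 / (4 * of_nat (Suc n) * (of_nat n + of_real \<nu> + 1)))
          = (norm z)\<^sup>2 / (4 * real (Suc n) * (real n + \<nu> + 1))"
    proof -
      have "(of_nat n + of_real \<nu> + 1 :: complex) = of_real (real n + \<nu> + 1)" by simp
      moreover have "real n + \<nu> + 1 \<ge> 0" using assms by linarith
      ultimately have "norm (of_nat n + of_real \<nu> + 1 :: complex) = real n + \<nu> + 1"
        by (simp only: norm_of_real abs_of_nonneg)
      thus ?thesis by (simp add: norm_divide norm_mult norm_power del: of_nat_Suc)
    qed
    also have "\<dots> \<le> 1 / 2"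
    proof -
      have A: "(norm z)\<^sup>2 + 1 \<le> real n + \<nu> + 1" using n by linarith
      have "(norm z)\<^sup>2 \<le> 1 * (real n + \<nu> + 1)" using A by simp
      also have "\<dots> \<le> 2 * real (Suc n) * (real n + \<nu> + 1)"
        using assms by (intro mult_right_mono) auto
      finally have "(norm z)\<^sup>2 \<le> 2 * real (Suc n) * (real n + \<nu> + 1)" .
      moreover have "4 * real (Suc n) * (real n + \<nu> + 1) > 0"
        using assms by (intro mult_pos_pos) auto
      ultimately show ?thesis by (subst pos_divide_le_eq) linarith+
    qed
    finally have le: "norm (z\<^sup>2 / (4 * of_nat (Suc n) * (of_nat n + of_real \<nu> + 1))) \<le> 1 / 2" .
    show ?thesis unfolding eq norm_mult norm_minus_cancel
      by (rule mult_right_mono[OF le]) simp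
  qed
  thus ?thesis by (intro summable_ratio_test[of "1/2"]) auto
qed

lemma bessel_g_power_series:
  assumes "\<nu> > -1"
  shows "bessel_g \<nu> z =
    (\<Sum>n. (-1) ^ n * Gamma (of_real \<nu> + 1) / (4 ^ n * fact n * Gamma (of_nat n + of_real \<nu> + 1))
          * z ^ (2 * n + 1))"
proof (cases "z = 0")
  case True
  thus ?thesis by (simp add: bessel_g_def)
next
  case False
  let ?G = "Gamma (of_real \<nu> + 1) :: complex"
  define c where "c = 2 powr (of_real \<nu>) * ?G * z powr (1 - of_real \<nu>)"
  let ?b = "\<lambda>n. (-1) ^ n / (fact n * Gamma (of_nat n + of_real \<nu> + 1))
            * (z / 2) powr (2 * of_nat n + of_real \<nu>)"
  let ?a = "\<lambda>n. (-1) ^ n * ?G / (4 ^ n * fact n * Gamma (of_nat n + of_real \<nu> + 1)) * z ^ (2 * n + 1)"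
  have G0: "?G \<noteq> 0"
    using shifted_not_nonpos_Int[OF assms, of 0] by (simp add: Gamma_eq_zero_iff)
  have ab: "?a n = c * ?b n" for n
  proof -
    have L: "Ln (z / 2) = Ln z - Ln 2"
      using Ln_divide_of_real[of 2 z] False by (simp add: Ln_of_real[of 2, simplified])
    have "z powr (1 - of_real \<nu>) * 2 powr (of_real \<nu>) * (z / 2) powr (2 * of_nat n + of_real \<nu>)
        = exp ((1 + 2 * of_nat n) * Ln z - (2 * of_nat n) * Ln 2)"
      using False by (simp add: powr_def L exp_add [symmetric] algebra_simps)
    also have "\<dots> = exp (of_nat (2 * n + 1) * Ln z) / exp (of_nat (2 * n) * Ln 2)"
      by (simp add: exp_diff)
    also have "\<dots> = z ^ (2 * n + 1) / 2 ^ (2 * n)"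
      unfolding exp_of_nat_mult using False by simp
    also have "\<dots> = z ^ (2 * n + 1) / 4 ^ n" by (simp add: power_mult)
    finally have "z powr (1 - of_real \<nu>) * 2 powr (of_real \<nu>) * (z / 2) powr (2 * of_nat n + of_real \<nu>)
        = z ^ (2 * n + 1) / 4 ^ n" .
    hence "?a n = ?G * ((-1) ^ n / (fact n * Gamma (of_nat n + of_real \<nu> + 1)))
                  * (z powr (1 - of_real \<nu>) * 2 powr (of_real \<nu>) * (z / 2) powr (2 * of_nat n + of_real \<nu>))"
      by (simp add: mult_ac)
    thus ?thesis by (simp add: c_def mult_ac)
  qed
  have c0: "c \<noteq> 0" using False G0 by (simp add: c_def)
  have "summable ?b"
    using bessel_series_summable[OF assms, of z] c0 unfolding ab summable_cmult_iff by blast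
  hence "(\<Sum>n. c * ?b n) = c * (\<Sum>n. ?b n)" by (rule suminf_mult)
  thus ?thesis unfolding ab using False by (simp add: bessel_g_def bessel_J_def c_def)
qed

end

theory Submission
  imports Defs
begin

text \<open>
  Write \<open>bessel_g \<nu> z = z * bessel_F \<nu> (z\<^sup>2)\<close> with the entire function
  \<open>bessel_F \<nu> w = (\<Sum>n. (-1) ^ n * w ^ n / (4 ^ n * n! * pochhammer (\<nu> + 1) n))\<close>, and consider
  the quotient \<open>bessel_K \<nu> (z\<^sup>2) = z * J\<^bsub>\<nu>\<^esub>(z) / J\<^bsub>\<nu>+1\<^esub>(z)\<close>. Everything in the theorem is a statement
  about this one function:

  \<^item> the logarithmic derivative is \<open>z * g'(z) / g(z) = 1 - w / bessel_K \<nu> w\<close> with \<open>w = z\<^sup>2\<close>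
    (\<open>log_derivative_bessel_g\<close>);
  \<^item> \<open>j\<^bsub>\<nu>,1\<^esub> = 1\<close> means \<open>bessel_K \<nu> 1 = 0\<close> (\<open>first_positive_zero_J_1_iff\<close>);
  \<^item> \<open>(1 - \<alpha>) * J\<^bsub>\<nu>\<^esub>(1) = J\<^bsub>\<nu>+1\<^esub>(1)\<close> means \<open>bessel_K \<nu> 1 = 1 / (1 - \<alpha>)\<close> (\<open>bessel_J_1_equation_iff\<close>).

  The three-term recurrence of the Bessel functions becomes the continued fraction
  \<open>bessel_K \<nu> w = 2 * (\<nu> + 1) - w / bessel_K (\<nu> + 1) w\<close> (\<open>bessel_K_rec\<close>). All signs in it are
  favourable: replacing \<open>w\<close> by a larger real number, or \<open>\<nu>\<close> by a smaller order, makes each partial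
  denominator smaller. Unrolling it, with a contraction argument instead of an infinite expansion,
  gives \<open>bessel_K \<nu> s \<le> norm (bessel_K \<mu> w)\<close> whenever \<open>norm w \<le> s \<le> 1\<close> and \<open>-1 < \<nu> \<le> \<mu>\<close>
  (\<open>bessel_K_le_norm_bessel_K\<close>).

  With \<open>\<mu> = \<nu>\<close> this shows that \<open>norm (w / bessel_K \<nu> w)\<close> is largest towards \<open>w = 1\<close>, so that \<open>g\<close> is
  starlike of order \<open>\<alpha>\<close> exactly if \<open>bessel_K \<nu> 1 \<ge> 1 / (1 - \<alpha>)\<close> (\<open>starlike_of_order_bessel_g_iff\<close>).
  Moreover \<open>bessel_K \<nu> 1\<close> is continuous and strictly increasing in \<open>\<nu>\<close>, negative for some
  \<open>\<nu> > -1\<close>, and unbounded above, so it takes every value \<open>c \<ge> 0\<close> exactly once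
  (\<open>ex1_bessel_K_1_eq\<close>): \<open>nu_tilde\<close> belongs to \<open>c = 0\<close> and \<open>nu2 \<alpha>\<close> to \<open>c = 1 / (1 - \<alpha>)\<close>. A few steps
  of the continued fraction yield rational bounds sharp enough to locate the two numerical constants.
\<close>

section \<open>The entire function behind the Bessel function\<close>

definition bessel_coeff :: "real \<Rightarrow> nat \<Rightarrow> real" where
  "bessel_coeff \<nu> n = (-1) ^ n / (4 ^ n * fact n * pochhammer (\<nu> + 1) n)"

text \<open>The generic type makes the same function available on the real line, where it is ordered,
  and on the complex plane.\<close>

definition bessel_F :: "real \<Rightarrow> 'a :: {real_normed_field, banach} \<Rightarrow> 'a" where
  "bessel_F \<nu> w = (\<Sum>n. of_real (bessel_coeff \<nu> n) * w ^ n)"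

lemma pochhammer_ge_one:
  fixes x :: real
  assumes "x \<ge> 1"
  shows "pochhammer x n \<ge> 1"
proof (induction n)
  case (Suc n)
  have "1 * 1 \<le> (x + real n) * pochhammer x n"
    using Suc assms by (intro mult_mono) auto
  thus ?case by (simp add: pochhammer_rec')
qed simp

lemma pochhammer_ge_min_one:
  fixes x :: real
  assumes "x > 0"
  shows "pochhammer x n \<ge> min 1 x"
proof (cases n)
  case (Suc m)
  have "x * 1 \<le> x * pochhammer (x + 1) m"
    using assms by (intro mult_left_mono pochhammer_ge_one) auto
  thus ?thesis by (simp add: Suc pochhammer_rec)
qed simp

lemma bessel_coeff_0 [simp]: "bessel_coeff \<nu> 0 = 1"
  by (simp add: bessel_coeff_def)

text \<open>For nonnegative order the coefficients are dominated by a geometric series, which serves both to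
  bound \<open>bessel_F\<close> away from \<open>0\<close> on the unit disk and to make it continuous in the order.\<close>

lemma abs_bessel_coeff_le:
  assumes "\<mu> \<ge> 0"
  shows "\<bar>bessel_coeff \<mu> n\<bar> \<le> (1 / 4) ^ n"
proof -
  have "(1::real) * 1 \<le> fact n * pochhammer (\<mu> + 1) n"
    using assms by (intro mult_mono pochhammer_ge_one) auto
  moreover from this have "pochhammer (\<mu> + 1) n > 0"
    by (simp add: assms add_nonneg_pos pochhammer_pos)
  ultimately show ?thesis
    by (simp add: bessel_coeff_def abs_mult power_divide divide_simps)
qed

text \<open>For \<open>-1 < \<nu> < 0\<close> the Pochhammer symbol may drop below \<open>1\<close>, but it stays above the constant
  \<open>min 1 (\<nu> + 1)\<close>, so the exponential series dominates.\<close>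

lemma summable_bessel_F:
  fixes w :: "'a :: {real_normed_field, banach}"
  assumes "\<nu> > -1"
  shows "summable (\<lambda>n. of_real (bessel_coeff \<nu> n) * w ^ n)"
proof -
  define m where "m = min 1 (\<nu> + 1)"
  have m: "m > 0" "pochhammer (\<nu> + 1) n \<ge> m" for n
    using assms pochhammer_ge_min_one[of "\<nu> + 1"] by (auto simp: m_def)
  have "norm (of_real (bessel_coeff \<nu> n) * w ^ n) \<le> (1 / m) * (inverse (fact n) * norm w ^ n)" for n
  proof -
    have p: "pochhammer (\<nu> + 1) n > 0" using m(1) m(2)[of n] by linarith
    have "fact n * m \<le> 4 ^ n * fact n * pochhammer (\<nu> + 1) n"
      using m(1) m(2)[of n] mult_mono[of 1 "4 ^ n" "fact n" "fact n :: real"]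
      by (intro mult_mono) auto
    hence "\<bar>bessel_coeff \<nu> n\<bar> \<le> 1 / (fact n * m)"
      using p m(1) by (simp add: bessel_coeff_def abs_mult frac_le)
    hence "\<bar>bessel_coeff \<nu> n\<bar> * norm w ^ n \<le> 1 / (fact n * m) * norm w ^ n"
      by (intro mult_right_mono) auto
    thus ?thesis by (simp add: norm_mult norm_power field_simps)
  qed
  moreover have "summable (\<lambda>n. (1 / m) * (inverse (fact n) * norm w ^ n))"
    by (intro summable_mult summable_exp)
  ultimately show ?thesis by (rule summable_comparison_test'[where N = 0, rotated])
qed

lemma bessel_F_of_real:
  assumes "\<nu> > -1"
  shows "bessel_F \<nu> (of_real x :: 'a :: {real_normed_field, banach}) = of_real (bessel_F \<nu> x)"
  using suminf_of_real[OF summable_bessel_F[OF assms, of x], where ?'a = 'a]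
  by (simp add: bessel_F_def)

lemma bessel_F_0 [simp]: "bessel_F \<nu> 0 = 1"
  unfolding bessel_F_def by (subst powser_zero) simp

lemma norm_bessel_F_diff_one_le:
  fixes w :: "'a :: {real_normed_field, banach}"
  assumes "\<mu> \<ge> 0" "norm w \<le> 1"
  shows "norm (bessel_F \<mu> w - 1) \<le> 1 / 3"
proof -
  let ?f = "\<lambda>n. of_real (bessel_coeff \<mu> n) * w ^ n"
  have sf: "summable ?f" using assms by (intro summable_bessel_F) auto
  have le: "norm (?f (Suc n)) \<le> (1 / 4) ^ Suc n" for n
  proof -
    have "\<bar>bessel_coeff \<mu> (Suc n)\<bar> * norm w ^ Suc n \<le> (1 / 4) ^ Suc n * 1"
      using assms by (intro mult_mono abs_bessel_coeff_le power_le_one) auto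
    thus ?thesis by (simp add: norm_mult norm_power del: power_Suc)
  qed
  have sg: "(\<lambda>n. (1 / 4 :: real) ^ Suc n) sums (1 / 3)"
    using sums_mult[OF geometric_sums[of "1 / 4 :: real"], of "1 / 4"] by simp
  have "bessel_F \<mu> w - 1 = (\<Sum>n. ?f (Suc n))"
    using suminf_split_head[OF sf] by (simp add: bessel_F_def)
  also have "norm \<dots> \<le> (\<Sum>n. (1 / 4) ^ Suc n)"
    using le sg by (intro norm_suminf_le) (auto simp: sums_iff)
  also have "\<dots> = 1 / 3" using sg by (simp add: sums_iff)
  finally show ?thesis .
qed

lemma norm_bessel_F_bounds:
  fixes w :: "'a :: {real_normed_field, banach}"
  assumes "\<mu> \<ge> 0" "norm w \<le> 1"
  shows "norm (bessel_F \<mu> w) \<ge> 2 / 3" "norm (bessel_F \<mu> w) \<le> 4 / 3"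
  using norm_bessel_F_diff_one_le[OF assms] norm_triangle_ineq2[of 1 "1 - bessel_F \<mu> w"]
    norm_triangle_ineq[of 1 "bessel_F \<mu> w - 1"] norm_minus_commute[of 1 "bessel_F \<mu> w"]
  by auto

lemma bessel_F_nonzero:
  fixes w :: "'a :: {real_normed_field, banach}"
  assumes "\<mu> \<ge> 0" "norm w \<le> 1"
  shows "bessel_F \<mu> w \<noteq> 0"
  using norm_bessel_F_bounds(1)[OF assms] by auto

text \<open>The recurrence \<open>J\<^bsub>\<nu>\<^esub>(z) + J\<^bsub>\<nu>+2\<^esub>(z) = (2 * (\<nu> + 1) / z) * J\<^bsub>\<nu>+1\<^esub>(z)\<close> without the power factors. It
  holds coefficientwise: the difference of \<open>1 / pochhammer (\<nu> + 1) m\<close> and \<open>1 / pochhammer (\<nu> + 2) m\<close>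
  has numerator \<open>m\<close>, which turns the factorial of \<open>m\<close> into that of \<open>m - 1\<close>.\<close>

lemma bessel_F_contiguous:
  fixes w :: "'a :: {real_normed_field, banach}"
  assumes "\<nu> > -1"
  shows "bessel_F \<nu> w = bessel_F (\<nu> + 1) w
           - w * bessel_F (\<nu> + 2) w / of_real (4 * (\<nu> + 1) * (\<nu> + 2))"
proof -
  let ?f = "\<lambda>\<nu> n. of_real (bessel_coeff \<nu> n) * w ^ n"
  let ?d = "4 * (\<nu> + 1) * (\<nu> + 2)"
  have coeff: "bessel_coeff \<nu> (Suc n) - bessel_coeff (\<nu> + 1) (Suc n) = - bessel_coeff (\<nu> + 2) n / ?d" for n
  proof -
    define p where "p = pochhammer (\<nu> + 3) n"
    define q where "q = \<nu> + 2 + real n"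
    have p: "p > 0" "q > 0" using assms by (auto simp: p_def q_def intro!: pochhammer_pos)
    have *: "pochhammer (\<nu> + 2) (Suc n) = (\<nu> + 2) * p"
      by (simp add: pochhammer_rec p_def add.commute)
    have a: "pochhammer (\<nu> + 2) n * q = (\<nu> + 2) * p"
      using * by (simp add: pochhammer_rec' q_def mult.commute)
    have b: "pochhammer (\<nu> + 1) (Suc n) = (\<nu> + 1) * ((\<nu> + 2) * p / q)"
      using a p by (simp add: pochhammer_rec field_simps)
    have q: "q = (\<nu> + 1) + real (Suc n)" by (simp add: q_def)
    have pos: "\<nu> + 1 > 0" "\<nu> + 2 > 0" "real (Suc n) > 0" using assms by auto
    have c: "pochhammer (\<nu> + 1 + 1) (Suc n) = (\<nu> + 2) * p" using * by (simp add: add.assoc)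
    have d: "pochhammer (\<nu> + 2 + 1) n = p" by (simp add: p_def add.assoc)
    have "1 / ((\<nu> + 1) * ((\<nu> + 2) * p / q)) - 1 / ((\<nu> + 2) * p)
            = real (Suc n) / ((\<nu> + 1) * ((\<nu> + 2) * p))"
      using pos p unfolding q by (simp add: divide_simps del: of_nat_Suc)
    hence "(-1) ^ Suc n / (4 ^ Suc n * fact (Suc n)) * (1 / ((\<nu> + 1) * ((\<nu> + 2) * p / q)) - 1 / ((\<nu> + 2) * p))
            = (-1) ^ Suc n / (4 ^ Suc n * fact (Suc n)) * (real (Suc n) / ((\<nu> + 1) * ((\<nu> + 2) * p)))"
      by simp
    also have "\<dots> = - ((-1) ^ n / (4 ^ n * fact n * p)) / ?d"
      using pos p by (simp add: fact_Suc divide_simps del: of_nat_Suc)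
    finally show ?thesis
      unfolding bessel_coeff_def b c d by (simp add: right_diff_distrib)
  qed
  have sm: "summable (?f \<nu>)" "summable (?f (\<nu> + 1))" "summable (?f (\<nu> + 2))"
    using assms by (auto intro!: summable_bessel_F)
  have "bessel_F \<nu> w - bessel_F (\<nu> + 1) w = (\<Sum>n. ?f \<nu> n - ?f (\<nu> + 1) n)"
    using sm by (simp add: bessel_F_def suminf_diff)
  also have "\<dots> = (\<Sum>n. ?f \<nu> (Suc n) - ?f (\<nu> + 1) (Suc n))"
    using suminf_split_head[OF summable_diff[OF sm(1,2)]] by simp
  also have "\<dots> = (\<Sum>n. (- w / of_real ?d) * ?f (\<nu> + 2) n)"
  proof (intro suminf_cong)
    fix n
    have "?f \<nu> (Suc n) - ?f (\<nu> + 1) (Suc n)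
        = of_real (bessel_coeff \<nu> (Suc n) - bessel_coeff (\<nu> + 1) (Suc n)) * w ^ Suc n"
      by (simp add: algebra_simps)
    thus "?f \<nu> (Suc n) - ?f (\<nu> + 1) (Suc n) = (- w / of_real ?d) * ?f (\<nu> + 2) n"
      unfolding coeff by simp
  qed
  also have "\<dots> = (- w / of_real ?d) * bessel_F (\<nu> + 2) w"
    unfolding bessel_F_def by (rule suminf_mult[OF sm(3)])
  finally show ?thesis by (simp add: algebra_simps)
qed

lemma has_field_derivative_bessel_F:
  fixes w :: "'a :: {real_normed_field, banach}"
  assumes "\<nu> > -1"
  shows "(bessel_F \<nu> has_field_derivative - bessel_F (\<nu> + 1) w / of_real (4 * (\<nu> + 1))) (at w)"
proof -
  let ?c = "\<lambda>n. of_real (bessel_coeff \<nu> n) :: 'a"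
  have coeff: "real (Suc n) * bessel_coeff \<nu> (Suc n) = - bessel_coeff (\<nu> + 1) n / (4 * (\<nu> + 1))" for n
    using assms by (simp add: bessel_coeff_def pochhammer_rec fact_Suc divide_simps del: of_nat_Suc)
  have "diffs ?c n = (- 1 / of_real (4 * (\<nu> + 1))) * of_real (bessel_coeff (\<nu> + 1) n)" for n
  proof -
    have "diffs ?c n = of_real (real (Suc n) * bessel_coeff \<nu> (Suc n))"
      by (simp add: diffs_def del: of_nat_Suc)
    thus ?thesis unfolding coeff by simp
  qed
  hence "(\<Sum>n. diffs ?c n * w ^ n)
      = (\<Sum>n. (- 1 / of_real (4 * (\<nu> + 1))) * (of_real (bessel_coeff (\<nu> + 1) n) * w ^ n))"
    by (simp add: mult.assoc)
  also have "\<dots> = (- 1 / of_real (4 * (\<nu> + 1))) * bessel_F (\<nu> + 1) w"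
    unfolding bessel_F_def using assms by (intro suminf_mult summable_bessel_F) auto
  finally have "(\<Sum>n. diffs ?c n * w ^ n) = - bessel_F (\<nu> + 1) w / of_real (4 * (\<nu> + 1))" by simp
  thus ?thesis
    using termdiffs_strong_converges_everywhere[of ?c w, OF summable_bessel_F[OF assms]]
    by (simp add: bessel_F_def [abs_def])
qed

lemma continuous_on_bessel_F:
  assumes "\<nu> > -1"
  shows "continuous_on A (bessel_F \<nu> :: 'a :: {real_normed_field, banach} \<Rightarrow> 'a)"
  using has_field_derivative_bessel_F[OF assms] DERIV_isCont continuous_at_imp_continuous_on by blast

lemma continuous_on_bessel_F_order:
  "continuous_on {0..} (\<lambda>\<mu>. bessel_F \<mu> (1::real))"
proof -
  have "uniform_limit {0..} (\<lambda>N \<mu>. \<Sum>n<N. bessel_coeff \<mu> n) (\<lambda>\<mu>. \<Sum>n. bessel_coeff \<mu> n) sequentially"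
    by (rule Weierstrass_m_test[where M = "\<lambda>n. (1 / 4) ^ n"])
       (auto intro: abs_bessel_coeff_le summable_geometric)
  moreover have "pochhammer (\<mu> + 1) n > 0" if "\<mu> \<ge> 0" for \<mu> :: real and n
    using that by (intro pochhammer_pos) auto
  hence "pochhammer (\<mu> + 1) n \<noteq> 0" if "\<mu> \<ge> 0" for \<mu> :: real and n
    using that by (metis less_irrefl)
  hence "continuous_on {0..} (\<lambda>\<mu>. \<Sum>n<N. bessel_coeff \<mu> n)" for N
    unfolding bessel_coeff_def by (intro continuous_intros) auto
  ultimately have "continuous_on {0..} (\<lambda>\<mu>. \<Sum>n. bessel_coeff \<mu> n)"
    by (intro uniform_limit_theorem[where F = sequentially]) auto
  thus ?thesis by (simp add: bessel_F_def)
qed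

section \<open>The continued fraction\<close>

text \<open>This is \<open>z * J\<^bsub>\<nu>\<^esub>(z) / J\<^bsub>\<nu>+1\<^esub>(z)\<close> in the variable \<open>w = z\<^sup>2\<close>. The denominator has no zeros for
  \<open>norm w \<le> 1\<close> and \<open>\<nu> \<ge> -1\<close> by \<open>bessel_F_nonzero\<close>.\<close>

definition bessel_K :: "real \<Rightarrow> 'a :: {real_normed_field, banach} \<Rightarrow> 'a" where
  "bessel_K \<nu> w = of_real (2 * (\<nu> + 1)) * bessel_F \<nu> w / bessel_F (\<nu> + 1) w"

lemma bessel_K_0: "\<nu> > -1 \<Longrightarrow> bessel_K \<nu> 0 = of_real (2 * (\<nu> + 1))"
  by (simp add: bessel_K_def)

lemma bessel_K_of_real:
  "\<nu> > -1 \<Longrightarrow> bessel_K \<nu> (of_real x :: 'a :: {real_normed_field, banach}) = of_real (bessel_K \<nu> x)"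
  by (simp add: bessel_K_def bessel_F_of_real)

lemma bessel_K_eq_0_iff:
  fixes w :: "'a :: {real_normed_field, banach}"
  assumes "\<nu> > -1" "norm w \<le> 1"
  shows "bessel_K \<nu> w = 0 \<longleftrightarrow> bessel_F \<nu> w = 0"
  using assms bessel_F_nonzero[of "\<nu> + 1" w] of_real_eq_0_iff[of "2 * (\<nu> + 1)", where ?'a = 'a]
  unfolding bessel_K_def by (simp del: of_real_mult of_real_add)

lemma bessel_K_rec:
  fixes w :: "'a :: {real_normed_field, banach}"
  assumes "\<nu> > -1" "norm w \<le> 1"
  shows "bessel_K \<nu> w = of_real (2 * (\<nu> + 1)) - w / bessel_K (\<nu> + 1) w"
proof -
  define A where "A = bessel_F (\<nu> + 1) w"
  define B where "B = bessel_F (\<nu> + 2) w"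
  define x y where "x = (of_real (\<nu> + 1) :: 'a)" and "y = (of_real (\<nu> + 2) :: 'a)"
  have nz: "A \<noteq> 0" "B \<noteq> 0" "x \<noteq> 0" "y \<noteq> 0"
    using assms bessel_F_nonzero[of "\<nu> + 1" w] bessel_F_nonzero[of "\<nu> + 2" w]
      of_real_eq_0_iff[of "\<nu> + 1", where ?'a = 'a] of_real_eq_0_iff[of "\<nu> + 2", where ?'a = 'a]
    unfolding A_def B_def x_def y_def by (simp_all del: of_real_add)
  have "bessel_K \<nu> w = 2 * x * (A - w * B / (4 * x * y)) / A"
    using bessel_F_contiguous[OF assms(1), of w] by (simp add: bessel_K_def A_def B_def x_def y_def)
  also have "\<dots> = 2 * x - w / (2 * y * A / B)"
    using nz by (simp add: field_simps)
  also have "2 * y * A / B = bessel_K (\<nu> + 1) w"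
    by (simp add: bessel_K_def A_def B_def y_def add.assoc)
  finally show ?thesis by (simp add: x_def)
qed

lemma norm_bessel_K_ge_rec:
  fixes w :: "'a :: {real_normed_field, banach}"
  assumes "\<mu> > -1" "norm w \<le> 1"
  shows "norm (bessel_K \<mu> w) \<ge> 2 * (\<mu> + 1) - norm w / norm (bessel_K (\<mu> + 1) w)"
proof -
  have "norm (of_real (2 * (\<mu> + 1)) :: 'a) = 2 * (\<mu> + 1)"
    using assms by (simp only: norm_of_real) simp
  thus ?thesis
    using norm_triangle_ineq2[of "of_real (2 * (\<mu> + 1))" "w / bessel_K (\<mu> + 1) w"] bessel_K_rec[OF assms]
    by (simp only: norm_divide)
qed

text \<open>The bounds on \<open>bessel_F\<close> alone give only \<open>norm (bessel_K \<mu> w) \<ge> \<mu> + 1\<close>. One step of the recursion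
  improves this at \<open>\<mu> = 0\<close> to a constant greater than \<open>1\<close>, which is what makes the recursion a strict
  contraction below.\<close>

lemma norm_bessel_K_ge:
  fixes w :: "'a :: {real_normed_field, banach}"
  assumes "\<mu> \<ge> 0" "norm w \<le> 1"
  shows "norm (bessel_K \<mu> w) \<ge> 3 / 2"
proof -
  have crude: "norm (bessel_K \<kappa> w) \<ge> \<kappa> + 1" if "\<kappa> \<ge> 0" for \<kappa>
  proof -
    have "2 / 3 \<le> norm (bessel_F \<kappa> w)" "norm (bessel_F (\<kappa> + 1) w) \<le> 4 / 3"
         "2 / 3 \<le> norm (bessel_F (\<kappa> + 1) w)"
      using norm_bessel_F_bounds[of \<kappa> w] norm_bessel_F_bounds[of "\<kappa> + 1" w] that assms by simp_all
    hence "1 / 2 \<le> norm (bessel_F \<kappa> w) / norm (bessel_F (\<kappa> + 1) w)"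
      by (subst pos_le_divide_eq) linarith+
    hence "(2 * (\<kappa> + 1)) * (1 / 2)
             \<le> (2 * (\<kappa> + 1)) * (norm (bessel_F \<kappa> w) / norm (bessel_F (\<kappa> + 1) w))"
      using that by (intro mult_left_mono) auto
    moreover have "norm (of_real (2 * (\<kappa> + 1)) :: 'a) = 2 * (\<kappa> + 1)"
      using that by (simp only: norm_of_real) simp
    ultimately show ?thesis by (simp only: bessel_K_def norm_divide norm_mult) simp
  qed
  have "norm (bessel_K (\<mu> + 1) w) \<ge> 2" using crude[of "\<mu> + 1"] assms by simp
  hence "norm w / norm (bessel_K (\<mu> + 1) w) \<le> 1 / 2"
    using assms by (intro frac_le) auto
  thus ?thesis using norm_bessel_K_ge_rec[of \<mu> w] assms by simp
qed

lemma bessel_K_ge: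
  fixes s :: real
  assumes "\<mu> \<ge> 0" "\<bar>s\<bar> \<le> 1"
  shows "bessel_K \<mu> s \<ge> 3 / 2"
proof -
  have "\<bar>bessel_F \<kappa> s - 1\<bar> \<le> 1 / 3" if "\<kappa> \<ge> 0" for \<kappa>
    using norm_bessel_F_diff_one_le[of \<kappa> s] assms that by simp
  from this[of \<mu>] this[of "\<mu> + 1"] have "bessel_F \<mu> s > 0" "bessel_F (\<mu> + 1) s > 0"
    using assms by linarith+
  hence "bessel_K \<mu> s > 0" using assms by (simp add: bessel_K_def)
  thus ?thesis using norm_bessel_K_ge[of \<mu> s] assms by simp
qed

text \<open>One step of the recursion on each side: the leading terms satisfy
  \<open>2 * (\<nu> + 1) \<le> 2 * (\<mu> + 1)\<close> and can be dropped, so only the quotients one level up remain.\<close>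

lemma bessel_K_diff_norm_bessel_K_le:
  fixes w :: "'a :: {real_normed_field, banach}"
  assumes "-1 < \<nu>" "\<nu> \<le> \<mu>" "norm w \<le> s" "s \<le> 1"
  shows "bessel_K \<nu> s - norm (bessel_K \<mu> w)
           \<le> s / norm (bessel_K (\<mu> + 1) w) - s / bessel_K (\<nu> + 1) s"
proof -
  have s: "0 \<le> s" using assms(3) norm_ge_zero[of w] by linarith
  have "bessel_K \<nu> s = 2 * (\<nu> + 1) - s / bessel_K (\<nu> + 1) s"
    using bessel_K_rec[of \<nu> s] assms s by simp
  moreover have "norm (bessel_K \<mu> w) \<ge> 2 * (\<mu> + 1) - norm w / norm (bessel_K (\<mu> + 1) w)"
    using assms by (intro norm_bessel_K_ge_rec) auto
  moreover have "norm w / norm (bessel_K (\<mu> + 1) w) \<le> s / norm (bessel_K (\<mu> + 1) w)"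
    using assms by (intro divide_right_mono) auto
  ultimately show ?thesis using assms(2) by argo
qed

text \<open>The key comparison. Passing to the next pair of orders contracts a positive difference
  \<open>bessel_K \<nu> s - norm (bessel_K \<mu> w)\<close> by the factor \<open>1 / 2\<close>, because both quantities at the
  next level are at least \<open>3 / 2\<close>. As the difference never exceeds \<open>1\<close>, it is below every power
  of \<open>1 / 2\<close>, hence not positive.

  Taking \<open>\<mu> = \<nu>\<close> locates the minimum of the modulus over a disk on the positive half-axis; taking
  \<open>w = s\<close> gives monotonicity in the order.\<close>

lemma bessel_K_le_norm_bessel_K:
  fixes w :: "'a :: {real_normed_field, banach}"
  assumes "-1 < \<nu>" "\<nu> \<le> \<mu>" "norm w \<le> s" "s \<le> 1"
  shows "bessel_K \<nu> s \<le> norm (bessel_K \<mu> w)"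
proof -
  have s: "0 \<le> s" using assms(3) norm_ge_zero[of w] by linarith
  have K_ge: "bessel_K (\<nu> + 1) s \<ge> 3 / 2" "norm (bessel_K (\<mu> + 1) w) \<ge> 3 / 2"
    if "-1 < \<nu>" "\<nu> \<le> \<mu>" for \<nu> \<mu>
    using that assms s bessel_K_ge[of "\<nu> + 1" s] norm_bessel_K_ge[of "\<mu> + 1" w] by simp_all
  have approx: "bessel_K \<nu> s - norm (bessel_K \<mu> w) \<le> (1 / 2) ^ N"
    if "-1 < \<nu>" "\<nu> \<le> \<mu>" for \<nu> \<mu> N
    using that
  proof (induction N arbitrary: \<nu> \<mu>)
    case (0 \<nu> \<mu>)
    have "s / norm (bessel_K (\<mu> + 1) w) \<le> 1 / 1"
      using assms s K_ge[OF 0] by (intro frac_le) auto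
    moreover have "0 \<le> s / bessel_K (\<nu> + 1) s" using s K_ge[OF 0] by simp
    ultimately show ?case
      using bessel_K_diff_norm_bessel_K_le[OF 0 assms(3,4)] by (simp only: power_0 div_by_1)
  next
    case (Suc N \<nu> \<mu>)
    define k where "k = bessel_K (\<nu> + 1) s"
    define q where "q = norm (bessel_K (\<mu> + 1) w)"
    have kq: "k \<ge> 3 / 2" "q \<ge> 3 / 2" using K_ge[OF Suc.prems] by (simp_all add: k_def q_def)
    have IH: "k - q \<le> (1 / 2) ^ N"
      using Suc.IH[of "\<nu> + 1" "\<mu> + 1"] Suc.prems by (simp add: k_def q_def)
    have "3 / 2 * (3 / 2) \<le> q * k" using kq by (intro mult_mono) auto
    hence qk: "2 \<le> q * k" by simp
    have "bessel_K \<nu> s - norm (bessel_K \<mu> w) \<le> s / q - s / k"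
      using bessel_K_diff_norm_bessel_K_le[OF Suc.prems assms(3,4)] by (simp add: k_def q_def)
    also have "s / q - s / k = s * (k - q) / (q * k)" using kq by (simp add: field_simps)
    also have "\<dots> \<le> 1 * (1 / 2) ^ N / 2"
    proof (cases "k \<le> q")
      case True
      hence "s * (k - q) / (q * k) \<le> 0"
        using s kq by (intro divide_nonpos_pos mult_nonneg_nonpos) auto
      thus ?thesis by (rule order.trans) simp
    next
      case False
      thus ?thesis using IH assms s qk by (intro frac_le mult_mono) auto
    qed
    finally show ?case by simp
  qed
  have "(\<lambda>N. (1 / 2 :: real) ^ N) \<longlonglongrightarrow> 0" by (intro LIMSEQ_realpow_zero) auto
  hence "bessel_K \<nu> s - norm (bessel_K \<mu> w) \<le> 0"
    using approx[OF assms(1,2)] by (intro LIMSEQ_le_const[where X = "\<lambda>N. (1 / 2) ^ N"]) auto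
  thus ?thesis by simp
qed

lemma bessel_K_less_norm_bessel_K:
  fixes w :: "'a :: {real_normed_field, banach}"
  assumes "-1 < \<nu>" "\<nu> \<le> \<mu>" "norm w < s" "s \<le> 1"
  shows "bessel_K \<nu> s < norm (bessel_K \<mu> w)"
proof -
  define k where "k = bessel_K (\<nu> + 1) s"
  define q where "q = norm (bessel_K (\<mu> + 1) w)"
  have s: "0 \<le> s" using assms(3) norm_ge_zero[of w] by linarith
  have k: "k \<ge> 3 / 2" using assms s unfolding k_def by (intro bessel_K_ge) auto
  have kq: "k \<le> q" unfolding k_def q_def using assms by (intro bessel_K_le_norm_bessel_K) auto
  have "norm w / q \<le> norm w / k" using k kq by (intro divide_left_mono) auto
  also have "\<dots> < s / k" using k assms by (intro divide_strict_right_mono) auto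
  finally have "norm w / q < s / k" .
  moreover have "bessel_K \<nu> s = 2 * (\<nu> + 1) - s / k"
    using bessel_K_rec[of \<nu> s] assms s by (simp add: k_def)
  moreover have "norm (bessel_K \<mu> w) \<ge> 2 * (\<mu> + 1) - norm w / q"
    unfolding q_def using assms by (intro norm_bessel_K_ge_rec) auto
  ultimately show ?thesis using assms(2) by argo
qed

lemma continuous_on_bessel_K:
  assumes "\<nu> > -1"
  shows "continuous_on {0..1} (bessel_K \<nu> :: real \<Rightarrow> real)"
  unfolding bessel_K_def
  using assms by (intro continuous_intros continuous_on_bessel_F) (auto simp: bessel_F_nonzero)

section \<open>Dependence on the order\<close>

lemma bessel_K_1_rec: "\<nu> > -1 \<Longrightarrow> bessel_K \<nu> (1::real) = 2 * (\<nu> + 1) - 1 / bessel_K (\<nu> + 1) 1"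
  using bessel_K_rec[of \<nu> "1::real"] by simp

lemma bessel_K_1_ge: "\<mu> \<ge> 0 \<Longrightarrow> bessel_K \<mu> (1::real) \<ge> 3 / 2"
  by (rule bessel_K_ge) auto

text \<open>The modulus in the comparison is harmless only at the positive order one level up; the recursion
  then carries the monotonicity down to orders where \<open>bessel_K\<close> may be negative.\<close>

lemma bessel_K_1_strict_mono:
  assumes "-1 < \<nu>" "\<nu> < \<mu>"
  shows "bessel_K \<nu> (1::real) < bessel_K \<mu> 1"
proof -
  have "bessel_K (\<nu> + 1) (1::real) \<le> bessel_K (\<mu> + 1) 1"
    using bessel_K_le_norm_bessel_K[of "\<nu> + 1" "\<mu> + 1" "1::real" 1] bessel_K_1_ge[of "\<mu> + 1"] assms by auto
  hence "1 / bessel_K (\<mu> + 1) (1::real) \<le> 1 / bessel_K (\<nu> + 1) 1"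
    using bessel_K_1_ge[of "\<nu> + 1"] assms by (intro frac_le) auto
  thus ?thesis using bessel_K_1_rec[of \<nu>] bessel_K_1_rec[of \<mu>] assms by simp
qed

lemma bessel_K_1_le_iff:
  "-1 < \<nu> \<Longrightarrow> -1 < \<mu> \<Longrightarrow> bessel_K \<nu> (1::real) \<le> bessel_K \<mu> 1 \<longleftrightarrow> \<nu> \<le> \<mu>"
  using bessel_K_1_strict_mono[of \<nu> \<mu>] bessel_K_1_strict_mono[of \<mu> \<nu>]
  by (cases \<nu> \<mu> rule: linorder_cases) auto

text \<open>The recursion moves the orders into the range \<open>{0..}\<close>, where the series converges uniformly in the
  order.\<close>

lemma continuous_on_bessel_K_1: "continuous_on {-1<..} (\<lambda>\<nu>. bessel_K \<nu> (1::real))"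
proof -
  let ?K = "\<lambda>\<nu>. 2 * (\<nu> + 2) * bessel_F (\<nu> + 1) (1::real) / bessel_F (\<nu> + 2) 1"
  have K: "bessel_K (\<nu> + 1) (1::real) = ?K \<nu>" for \<nu>
    by (simp add: bessel_K_def add.assoc)
  have nz: "?K \<nu> \<noteq> 0" if "\<nu> > -1" for \<nu>
    using bessel_K_1_ge[of "\<nu> + 1"] that unfolding K by auto
  have "continuous_on {-1<..} (\<lambda>\<nu>. 2 * (\<nu> + 1) - 1 / ?K \<nu>)"
    using nz
    by (intro continuous_intros continuous_on_compose2[OF continuous_on_bessel_F_order])
       (auto simp: bessel_F_nonzero)
  moreover have "2 * (\<nu> + 1) - 1 / ?K \<nu> = bessel_K \<nu> 1" if "\<nu> \<in> {-1<..}" for \<nu>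
    using bessel_K_1_rec[of \<nu>] that unfolding K by simp
  ultimately show ?thesis by (rule continuous_on_eq)
qed

lemma bessel_K_1_upper_step:
  assumes "\<nu> > -1" "bessel_K (\<nu> + 1) (1::real) \<le> u"
  shows "bessel_K \<nu> (1::real) \<le> 2 * (\<nu> + 1) - 1 / u"
proof -
  have "1 / u \<le> 1 / bessel_K (\<nu> + 1) 1"
    using bessel_K_1_ge[of "\<nu> + 1"] assms by (intro frac_le) auto
  thus ?thesis using bessel_K_1_rec[OF assms(1)] by simp
qed

lemma bessel_K_1_lower_step:
  assumes "\<nu> > -1" "l \<le> bessel_K (\<nu> + 1) (1::real)" "0 < l"
  shows "2 * (\<nu> + 1) - 1 / l \<le> bessel_K \<nu> (1::real)"
proof -
  have "1 / bessel_K (\<nu> + 1) 1 \<le> 1 / l"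
    using bessel_K_1_ge[of "\<nu> + 1"] assms by (intro frac_le) auto
  thus ?thesis using bessel_K_1_rec[OF assms(1)] by simp
qed

lemma bessel_K_1_le: "\<nu> > -1 \<Longrightarrow> bessel_K \<nu> (1::real) \<le> 2 * (\<nu> + 1)"
  using bessel_K_1_rec[of \<nu>] bessel_K_1_ge[of "\<nu> + 1"] by simp

lemma bessel_K_1_upper:
  assumes "\<nu> > -1"
  shows "bessel_K \<nu> (1::real)
           \<le> 2 * (\<nu> + 1) - 1 / (2 * (\<nu> + 2) - 1 / (2 * (\<nu> + 3) - 1 / (2 * (\<nu> + 4) - 1 / (2 * (\<nu> + 5)))))"
proof -
  have "bessel_K (\<nu> + 4) (1::real) \<le> 2 * (\<nu> + 5)"
    using bessel_K_1_le[of "\<nu> + 4"] assms by (simp add: add.assoc)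
  from bessel_K_1_upper_step[of "\<nu> + 3", unfolded add.assoc, simplified, OF _ this]
  have "bessel_K (\<nu> + 3) (1::real) \<le> 2 * (\<nu> + 4) - 1 / (2 * (\<nu> + 5))" using assms by simp
  from bessel_K_1_upper_step[of "\<nu> + 2", unfolded add.assoc, simplified, OF _ this]
  have "bessel_K (\<nu> + 2) (1::real) \<le> 2 * (\<nu> + 3) - 1 / (2 * (\<nu> + 4) - 1 / (2 * (\<nu> + 5)))"
    using assms by simp
  from bessel_K_1_upper_step[of "\<nu> + 1", unfolded add.assoc, simplified, OF _ this]
  have "bessel_K (\<nu> + 1) (1::real)
      \<le> 2 * (\<nu> + 2) - 1 / (2 * (\<nu> + 3) - 1 / (2 * (\<nu> + 4) - 1 / (2 * (\<nu> + 5))))"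
    using assms by simp
  from bessel_K_1_upper_step[OF assms this] show ?thesis .
qed

text \<open>Starting the continued fraction from the trivial bounds \<open>bessel_K (\<nu> + 4) 1 \<le> 2 * (\<nu> + 5)\<close> and
  \<open>bessel_K (\<nu> + 5) 1 \<ge> 3 / 2\<close> is enough: each level divides the error by the square of the current
  value.\<close>

lemma bessel_K_numeric:
  "bessel_K (- 0.7746) (1::real) < 0" "bessel_K (- 0.7745) (1::real) > 0"
  "bessel_K (- 0.3402) (1::real) < 1" "bessel_K (- 0.3392) (1::real) > 1"
proof -
  show "bessel_K (- 0.7746) (1::real) < 0" "bessel_K (- 0.3402) (1::real) < 1"
    by (rule order.strict_trans1[OF bessel_K_1_upper]; simp)+
  have lower: "bessel_K \<nu> (1::real) \<ge> 2 * (\<nu> + 1) - 1 / l1"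
    if "\<nu> > -1" "l4 = 2 * (\<nu> + 5) - 2 / 3" "l3 = 2 * (\<nu> + 4) - 1 / l4" "l2 = 2 * (\<nu> + 3) - 1 / l3" "l1 = 2 * (\<nu> + 2) - 1 / l2"
       "l1 > 0" "l2 > 0" "l3 > 0" "l4 > 0" for \<nu> l1 l2 l3 l4
  proof -
    have "bessel_K (\<nu> + 5) (1::real) \<ge> 3 / 2" using that(1) bessel_K_1_ge[of "\<nu> + 5"] by simp
    from bessel_K_1_lower_step[of "\<nu> + 4" "3 / 2"] this
    have "bessel_K (\<nu> + 4) (1::real) \<ge> l4" using that(1,2) by (simp add: add.assoc)
    from bessel_K_1_lower_step[of "\<nu> + 3" l4] this
    have "bessel_K (\<nu> + 3) (1::real) \<ge> l3" using that(1,3,9) by (simp add: add.assoc)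
    from bessel_K_1_lower_step[of "\<nu> + 2" l3] this
    have "bessel_K (\<nu> + 2) (1::real) \<ge> l2" using that(1,4,8) by (simp add: add.assoc)
    from bessel_K_1_lower_step[of "\<nu> + 1" l2] this
    have "bessel_K (\<nu> + 1) (1::real) \<ge> l1" using that(1,5,7) by (simp add: add.assoc)
    from bessel_K_1_lower_step[of "\<nu>" l1, OF _ this] show ?thesis using that(1,6) by simp
  qed
  show "bessel_K (- 0.7745) (1::real) > 0"
    by (rule order.strict_trans2[OF _ lower[OF _ refl refl refl refl]]; simp)
  show "bessel_K (- 0.3392) (1::real) > 1"
    by (rule order.strict_trans2[OF _ lower[OF _ refl refl refl refl]]; simp)
qed

text \<open>The intermediate value theorem applies between \<open>-0.7746\<close>, where the value is negative, and \<open>c\<close>,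
  where it is at least \<open>2 * (c + 1) - 1 \<ge> c\<close>.\<close>

lemma ex1_bessel_K_1_eq:
  assumes "c \<ge> 0"
  shows "\<exists>!\<nu>. \<nu> > -1 \<and> bessel_K \<nu> (1::real) = c"
proof -
  have "1 / bessel_K (c + 1) (1::real) \<le> 1 / 1"
    using bessel_K_1_ge[of "c + 1"] assms by (intro frac_le) auto
  hence "c \<le> bessel_K c (1::real)"
    using bessel_K_1_rec[of c] assms by simp
  moreover have "continuous_on {-0.7746..c} (\<lambda>\<nu>. bessel_K \<nu> (1::real))"
    by (rule continuous_on_subset[OF continuous_on_bessel_K_1]) auto
  ultimately obtain \<nu> where "\<nu> \<ge> -0.7746" "bessel_K \<nu> (1::real) = c"
    using IVT'[of "\<lambda>\<nu>. bessel_K \<nu> (1::real)" "-0.7746" c c] bessel_K_numeric(1) assms by auto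
  hence \<nu>: "\<nu> > -1 \<and> bessel_K \<nu> (1::real) = c" by simp
  show ?thesis
  proof (rule ex1I)
    fix \<mu> assume "\<mu> > -1 \<and> bessel_K \<mu> (1::real) = c"
    thus "\<mu> = \<nu>"
      using \<nu> bessel_K_1_strict_mono[of \<mu> \<nu>] bessel_K_1_strict_mono[of \<nu> \<mu>]
      by (cases \<mu> \<nu> rule: linorder_cases) auto
  qed (rule \<nu>)
qed

section \<open>Starlikeness\<close>

lemma bessel_g_eq_bessel_F:
  assumes "\<nu> > -1"
  shows "bessel_g \<nu> z = z * bessel_F \<nu> (z\<^sup>2)"
proof -
  have np: "of_real \<nu> + 1 \<notin> (\<int>\<^sub>\<le>\<^sub>0 :: complex set)"
    using shifted_not_nonpos_Int[OF assms, of 0] by simp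
  have G: "Gamma (of_real \<nu> + 1 :: complex) \<noteq> 0" using np by (simp add: Gamma_eq_zero_iff)
  have "(-1) ^ n * Gamma (of_real \<nu> + 1) / (4 ^ n * fact n * Gamma (of_nat n + of_real \<nu> + 1)) * z ^ (2 * n + 1)
      = z * (of_real (bessel_coeff \<nu> n) * (z\<^sup>2) ^ n)" for n
  proof -
    have "of_real (pochhammer (\<nu> + 1) n) = pochhammer (of_real \<nu> + 1 :: complex) n"
      using pochhammer_of_real[of "\<nu> + 1" n, where ?'a = complex] by simp
    also have "\<dots> = Gamma (of_nat n + of_real \<nu> + 1) / Gamma (of_real \<nu> + 1)"
      using pochhammer_Gamma[OF np, of n] by (simp add: add_ac)
    finally show ?thesis
      using G by (simp add: bessel_coeff_def mult_ac flip: power_mult)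
  qed
  hence "bessel_g \<nu> z = (\<Sum>n. z * (of_real (bessel_coeff \<nu> n) * (z\<^sup>2) ^ n))"
    using bessel_g_power_series[OF assms, of z] by simp
  also have "\<dots> = z * bessel_F \<nu> (z\<^sup>2)"
    unfolding bessel_F_def by (intro suminf_mult summable_bessel_F assms)
  finally show ?thesis .
qed

lemma has_field_derivative_bessel_g:
  assumes "\<nu> > -1"
  shows "(bessel_g \<nu> has_field_derivative
           (bessel_F \<nu> (z\<^sup>2) - z\<^sup>2 * bessel_F (\<nu> + 1) (z\<^sup>2) / of_real (2 * (\<nu> + 1)))) (at z)"
proof -
  define c :: complex where "c = of_real (2 * (\<nu> + 1))"
  have c: "c \<noteq> 0" using assms unfolding c_def of_real_eq_0_iff by simp
  have F: "(bessel_F \<nu> has_field_derivative - bessel_F (\<nu> + 1) w / (2 * c)) (at w)" for w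
    using has_field_derivative_bessel_F[OF assms, of w] by (simp add: c_def)
  have "((\<lambda>z. z * bessel_F \<nu> (z\<^sup>2)) has_field_derivative
           (bessel_F \<nu> (z\<^sup>2) - z\<^sup>2 * bessel_F (\<nu> + 1) (z\<^sup>2) / c)) (at z)"
    by (rule derivative_eq_intros DERIV_chain2[OF F] refl)+
       (use c in \<open>simp add: field_simps power2_eq_square\<close>)
  thus ?thesis by (simp add: bessel_g_eq_bessel_F[OF assms, abs_def] c_def)
qed

lemma log_derivative_bessel_g:
  assumes "\<nu> > -1" "z \<noteq> 0" "norm z \<le> 1" "bessel_F \<nu> (z\<^sup>2) \<noteq> 0"
  shows "z * deriv (bessel_g \<nu>) z / bessel_g \<nu> z = 1 - z\<^sup>2 / bessel_K \<nu> (z\<^sup>2)"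
proof -
  define c :: complex where "c = of_real (2 * (\<nu> + 1))"
  have c: "c \<noteq> 0" using assms unfolding c_def of_real_eq_0_iff by simp
  have "norm (z\<^sup>2) \<le> 1" using assms by (simp add: norm_power power_le_one)
  hence F: "bessel_F (\<nu> + 1) (z\<^sup>2) \<noteq> 0" using assms by (intro bessel_F_nonzero) auto
  have "z * deriv (bessel_g \<nu>) z / bessel_g \<nu> z
      = z * (bessel_F \<nu> (z\<^sup>2) - z\<^sup>2 * bessel_F (\<nu> + 1) (z\<^sup>2) / c) / (z * bessel_F \<nu> (z\<^sup>2))"
    unfolding c_def DERIV_imp_deriv[OF has_field_derivative_bessel_g[OF assms(1)]]
      bessel_g_eq_bessel_F[OF assms(1)] ..
  also have "\<dots> = 1 - z\<^sup>2 / (c * bessel_F \<nu> (z\<^sup>2) / bessel_F (\<nu> + 1) (z\<^sup>2))"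
    using assms c F by (simp add: divide_simps)
  finally show ?thesis unfolding bessel_K_def c_def .
qed

text \<open>If \<open>bessel_K \<nu> 1\<close> is large enough, the comparison bounds \<open>w / bessel_K \<nu> w\<close> by less than \<open>1 - \<alpha>\<close>
  in the whole open disk and excludes zeros of \<open>bessel_g\<close>. Conversely it suffices to test the
  starlikeness at real \<open>z\<close>: there \<open>bessel_K \<nu>\<close> starts from a positive value at \<open>0\<close> and cannot vanish, so
  \<open>s / bessel_K \<nu> s < 1 - \<alpha>\<close> gives a lower bound for \<open>bessel_K \<nu> s\<close>, which survives as \<open>s\<close> tends
  to \<open>1\<close>. The strict inequality in the open disk becomes a non-strict one at the endpoint.\<close>

lemma starlike_of_order_bessel_g_iff:
  assumes "\<nu> > -1" "\<alpha> < 1"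
  shows "starlike_of_order \<alpha> (bessel_g \<nu>) \<longleftrightarrow> 1 / (1 - \<alpha>) \<le> bessel_K \<nu> 1"
proof
  assume K1: "1 / (1 - \<alpha>) \<le> bessel_K \<nu> 1"
  hence Kpos: "bessel_K \<nu> (1::real) > 0" using assms(2) by (intro order.strict_trans2[OF _ K1]) simp
  have "bessel_g \<nu> z \<noteq> 0 \<and> Re (z * deriv (bessel_g \<nu>) z / bessel_g \<nu> z) > \<alpha>"
    if z: "z \<in> ball 0 1 - {0}" for z
  proof -
    from z have w: "norm (z\<^sup>2) < 1" by (simp add: norm_power power_less_one_iff)
    have le: "bessel_K \<nu> 1 \<le> norm (bessel_K \<nu> (z\<^sup>2))"
      using assms w by (intro bessel_K_le_norm_bessel_K) auto
    hence F: "bessel_F \<nu> (z\<^sup>2) \<noteq> 0"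
      using Kpos bessel_K_eq_0_iff[of \<nu> "z\<^sup>2"] assms w by auto
    have "norm (z\<^sup>2) / norm (bessel_K \<nu> (z\<^sup>2)) \<le> norm (z\<^sup>2) / bessel_K \<nu> 1"
      using le Kpos by (intro divide_left_mono mult_pos_pos) auto
    also have "\<dots> < 1 / bessel_K \<nu> 1" using w Kpos by (intro divide_strict_right_mono) auto
    also have "\<dots> \<le> 1 - \<alpha>" using K1 Kpos assms by (simp add: field_simps)
    finally have "norm (z\<^sup>2 / bessel_K \<nu> (z\<^sup>2)) < 1 - \<alpha>" by (simp add: norm_divide)
    moreover have "z * deriv (bessel_g \<nu>) z / bessel_g \<nu> z = 1 - z\<^sup>2 / bessel_K \<nu> (z\<^sup>2)"
      using z F assms by (intro log_derivative_bessel_g) auto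
    ultimately have "Re (z * deriv (bessel_g \<nu>) z / bessel_g \<nu> z) > \<alpha>"
      using complex_Re_le_cmod[of "z\<^sup>2 / bessel_K \<nu> (z\<^sup>2)"] by simp
    thus ?thesis using F z assms by (simp add: bessel_g_eq_bessel_F)
  qed
  moreover have "bessel_g \<nu> holomorphic_on ball 0 1"
    unfolding holomorphic_on_def field_differentiable_def
    using has_field_derivative_at_within[OF has_field_derivative_bessel_g[OF assms(1)]] by blast
  moreover have "deriv (bessel_g \<nu>) 0 = 1"
    by (simp add: DERIV_imp_deriv[OF has_field_derivative_bessel_g[OF assms(1)]])
  ultimately show "starlike_of_order \<alpha> (bessel_g \<nu>)"
    by (simp add: starlike_of_order_def bessel_g_def)
next
  assume star: "starlike_of_order \<alpha> (bessel_g \<nu>)"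
  have K: "bessel_K \<nu> s \<noteq> 0 \<and> s / bessel_K \<nu> s < 1 - \<alpha>" if s: "0 < s" "s < 1" for s :: real
  proof -
    define z where "z = complex_of_real (sqrt s)"
    have z: "z \<in> ball 0 1 - {0}" "z\<^sup>2 = of_real s"
      using s by (auto simp: z_def simp flip: of_real_power)
    from star z have g: "bessel_g \<nu> z \<noteq> 0" "Re (z * deriv (bessel_g \<nu>) z / bessel_g \<nu> z) > \<alpha>"
      unfolding starlike_of_order_def by blast+
    hence F: "bessel_F \<nu> (z\<^sup>2) \<noteq> 0" using assms by (simp add: bessel_g_eq_bessel_F)
    hence "bessel_F \<nu> s \<noteq> 0" unfolding z(2) using assms by (simp add: bessel_F_of_real)
    hence "bessel_K \<nu> s \<noteq> 0" using s assms bessel_K_eq_0_iff[of \<nu> s] by simp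
    moreover have "z * deriv (bessel_g \<nu>) z / bessel_g \<nu> z = 1 - z\<^sup>2 / bessel_K \<nu> (z\<^sup>2)"
      using z F assms by (intro log_derivative_bessel_g) auto
    hence "z * deriv (bessel_g \<nu>) z / bessel_g \<nu> z = of_real (1 - s / bessel_K \<nu> s)"
      unfolding z(2) using assms by (simp add: bessel_K_of_real)
    ultimately show ?thesis using g(2) by (simp only: Re_complex_of_real) simp
  qed
  have pos: "bessel_K \<nu> s > 0" if s: "0 < s" "s < 1" for s :: real
  proof (rule ccontr)
    assume "\<not> bessel_K \<nu> s > 0"
    moreover have "bessel_K \<nu> (0::real) > 0" using assms by (simp add: bessel_K_0)
    moreover have "continuous_on {0..s} (bessel_K \<nu> :: real \<Rightarrow> real)"
      using s by (intro continuous_on_subset[OF continuous_on_bessel_K] assms) auto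
    ultimately obtain x where x: "0 \<le> x" "x \<le> s" "bessel_K \<nu> x = 0"
      using IVT2'[of "bessel_K \<nu> :: real \<Rightarrow> real" s 0 0] s by auto
    moreover have "x \<noteq> 0" using x assms by (auto simp: bessel_K_0)
    ultimately show False using K[of x] s by auto
  qed
  have "s - (1 - \<alpha>) * bessel_K \<nu> s \<le> 0" if "s \<in> {0<..<1}" for s :: real
    using K[of s] pos[of s] that by (simp add: field_simps)
  moreover have "continuous_on (closure {0<..<1}) (\<lambda>s::real. s - (1 - \<alpha>) * bessel_K \<nu> s)"
    using assms by (simp add: continuous_on_bessel_K continuous_intros)
  ultimately have "1 - (1 - \<alpha>) * bessel_K \<nu> (1::real) \<le> 0"
    by (intro continuous_le_on_closure[where S = "{0<..<1}" and x = 1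
          and f = "\<lambda>s. s - (1 - \<alpha>) * bessel_K \<nu> s"]) auto
  thus "1 / (1 - \<alpha>) \<le> bessel_K \<nu> 1" using assms by (simp add: field_simps)
qed

section \<open>The two transcendental equations\<close>

lemma bessel_J_of_real_eq:
  assumes "\<nu> > -1" "x > 0"
  shows "2 powr of_real \<nu> * Gamma (of_real \<nu> + 1) * of_real x powr (1 - of_real \<nu>) * bessel_J \<nu> (of_real x)
           = of_real x * bessel_F \<nu> (of_real (x\<^sup>2))"
  using bessel_g_eq_bessel_F[OF assms(1), of "of_real x"] assms(2) by (simp add: bessel_g_def)

lemma Gamma_order_nonzero: "\<nu> > -1 \<Longrightarrow> Gamma (of_real \<nu> + 1 :: complex) \<noteq> 0"
  using shifted_not_nonpos_Int[of \<nu> 0] by (simp add: Gamma_eq_zero_iff)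

lemma bessel_J_of_real_eq_0_iff:
  assumes "\<nu> > -1" "0 < x" "x \<le> 1"
  shows "bessel_J \<nu> (of_real x) = 0 \<longleftrightarrow> bessel_K \<nu> (x\<^sup>2) = 0"
proof -
  have "bessel_J \<nu> (of_real x) = 0 \<longleftrightarrow> bessel_F \<nu> (complex_of_real (x\<^sup>2)) = 0"
    using bessel_J_of_real_eq[OF assms(1,2)] Gamma_order_nonzero[OF assms(1)] assms(2)
    by (metis mult_eq_0_iff of_real_eq_0_iff powr_eq_0_iff less_irrefl zero_neq_numeral)
  also have "\<dots> \<longleftrightarrow> bessel_F \<nu> (x\<^sup>2) = 0"
    unfolding bessel_F_of_real[OF assms(1)] by simp
  also have "\<dots> \<longleftrightarrow> bessel_K \<nu> (x\<^sup>2) = 0"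
    using assms by (intro bessel_K_eq_0_iff[symmetric]) (auto simp: power_le_one)
  finally show ?thesis .
qed

text \<open>A zero of \<open>bessel_K \<nu>\<close> at \<open>1\<close> is the first one because the strict comparison forces
  \<open>bessel_K \<nu> (y\<^sup>2)\<close> to be nonzero for \<open>0 < y < 1\<close>.\<close>

lemma first_positive_zero_J_1_iff:
  assumes "\<nu> > -1"
  shows "first_positive_zero_J \<nu> 1 \<longleftrightarrow> bessel_K \<nu> (1::real) = 0"
proof -
  have "bessel_J \<nu> (of_real y) \<noteq> 0" if "bessel_K \<nu> (1::real) = 0" "0 < y" "y < 1" for y
  proof -
    have "y\<^sup>2 < 1" using that by (simp add: power_less_one_iff)
    hence "bessel_K \<nu> 1 < norm (bessel_K \<nu> (y\<^sup>2))"
      using assms that by (intro bessel_K_less_norm_bessel_K) auto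
    thus ?thesis using that bessel_J_of_real_eq_0_iff[of \<nu> y] assms by auto
  qed
  thus ?thesis
    using bessel_J_of_real_eq_0_iff[of \<nu> 1] assms by (auto simp: first_positive_zero_J_def)
qed

text \<open>The ratio of the normalising factors of \<open>J\<^bsub>\<nu>+1\<^esub>\<close> and \<open>J\<^bsub>\<nu>\<^esub>\<close> at \<open>1\<close> is \<open>2 * (\<nu> + 1)\<close>, by the
  functional equation of the Gamma function.\<close>

lemma bessel_J_1_equation_iff:
  assumes "\<nu> > -1" "\<alpha> < 1"
  shows "(1 - of_real \<alpha>) * bessel_J \<nu> 1 = bessel_J (\<nu> + 1) 1 \<longleftrightarrow> bessel_K \<nu> 1 = 1 / (1 - \<alpha>)"
proof -
  define c :: complex where "c = 2 powr of_real \<nu> * Gamma (of_real \<nu> + 1)"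
  have c: "c \<noteq> 0" using Gamma_order_nonzero[OF assms(1)] by (simp add: c_def)
  have x: "\<nu> + 1 \<noteq> 0" using assms by simp
  have np: "of_real \<nu> + 1 \<notin> (\<int>\<^sub>\<le>\<^sub>0 :: complex set)"
    using shifted_not_nonpos_Int[OF assms(1), of 0] by simp
  have J0: "c * bessel_J \<nu> 1 = of_real (bessel_F \<nu> 1)"
    using bessel_J_of_real_eq[of \<nu> 1] bessel_F_of_real[of \<nu> 1, where ?'a = complex] assms by (simp add: c_def)
  have "2 powr of_real (\<nu> + 1) * Gamma (of_real (\<nu> + 1) + 1) = of_real (2 * (\<nu> + 1)) * c"
    using Gamma_plus1[OF np] by (simp add: c_def powr_add mult_ac)
  hence J1: "of_real (2 * (\<nu> + 1)) * c * bessel_J (\<nu> + 1) 1 = of_real (bessel_F (\<nu> + 1) 1)"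
    using bessel_J_of_real_eq[of "\<nu> + 1" 1] bessel_F_of_real[of "\<nu> + 1" 1, where ?'a = complex] assms by simp
  define d :: complex where "d = of_real (2 * (\<nu> + 1)) * c"
  have d: "d \<noteq> 0" using c x of_real_eq_0_iff[of "2 * (\<nu> + 1)", where ?'a = complex]
    unfolding d_def by (simp del: of_real_mult of_real_add)
  have "(1 - of_real \<alpha>) * bessel_J \<nu> 1 = bessel_J (\<nu> + 1) 1
     \<longleftrightarrow> d * ((1 - of_real \<alpha>) * bessel_J \<nu> 1) = d * bessel_J (\<nu> + 1) 1"
    using d by simp
  also have "d * ((1 - of_real \<alpha>) * bessel_J \<nu> 1) = of_real ((1 - \<alpha>) * (2 * (\<nu> + 1)) * bessel_F \<nu> 1)"
    using J0 by (simp add: d_def mult_ac)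
  also have "d * bessel_J (\<nu> + 1) 1 = of_real (bessel_F (\<nu> + 1) 1)"
    using J1 by (simp add: d_def)
  also have "of_real ((1 - \<alpha>) * (2 * (\<nu> + 1)) * bessel_F \<nu> 1) = complex_of_real (bessel_F (\<nu> + 1) 1)
     \<longleftrightarrow> (1 - \<alpha>) * (2 * (\<nu> + 1)) * bessel_F \<nu> 1 = bessel_F (\<nu> + 1) 1"
    by (rule of_real_eq_iff)
  also have "\<dots> \<longleftrightarrow> bessel_K \<nu> 1 = 1 / (1 - \<alpha>)"
    using bessel_F_nonzero[of "\<nu> + 1" "1::real"] assms
    by (simp only: bessel_K_def of_real_eq_id id_apply divide_eq_eq eq_divide_eq) (auto simp: algebra_simps)
  finally show ?thesis .
qed

lemma nu_tilde_eqs: "nu_tilde > -1" "bessel_K nu_tilde (1::real) = 0"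
  and ex1_first_positive_zero_J: "\<exists>!\<nu>. \<nu> > -1 \<and> first_positive_zero_J \<nu> 1"
proof -
  show ex1: "\<exists>!\<nu>. \<nu> > -1 \<and> first_positive_zero_J \<nu> 1"
    using ex1_bessel_K_1_eq[of 0] first_positive_zero_J_1_iff by (metis order.refl)
  have "nu_tilde > -1 \<and> first_positive_zero_J nu_tilde 1"
    unfolding nu_tilde_def by (rule theI'[OF ex1])
  thus "nu_tilde > -1" "bessel_K nu_tilde (1::real) = 0"
    using first_positive_zero_J_1_iff by auto
qed

text \<open>The condition \<open>\<nu> > nu_tilde\<close> may be exchanged for \<open>\<nu> > -1\<close>: a positive value of \<open>bessel_K \<nu> 1\<close>
  already puts \<open>\<nu>\<close> to the right of its zero.\<close>

lemma nu2_eqs: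
  assumes "\<alpha> < 1"
  shows ex1_nu2: "\<exists>!\<nu>. \<nu> > nu_tilde \<and> (1 - of_real \<alpha>) * bessel_J \<nu> 1 = bessel_J (\<nu> + 1) 1"
    and nu2_gt: "nu2 \<alpha> > nu_tilde"
    and nu2_J: "(1 - of_real \<alpha>) * bessel_J (nu2 \<alpha>) 1 = bessel_J (nu2 \<alpha> + 1) 1"
    and nu2_K: "bessel_K (nu2 \<alpha>) 1 = 1 / (1 - \<alpha>)"
proof -
  have "\<nu> > nu_tilde \<and> (1 - of_real \<alpha>) * bessel_J \<nu> 1 = bessel_J (\<nu> + 1) 1
     \<longleftrightarrow> \<nu> > -1 \<and> bessel_K \<nu> 1 = 1 / (1 - \<alpha>)" for \<nu>
  proof -
    have "\<nu> > nu_tilde" if "\<nu> > -1" "bessel_K \<nu> 1 = 1 / (1 - \<alpha>)"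
      using that bessel_K_1_le_iff[of \<nu> nu_tilde] nu_tilde_eqs assms by (simp add: not_le)
    thus ?thesis using bessel_J_1_equation_iff[of \<nu> \<alpha>] nu_tilde_eqs(1) assms by auto
  qed
  thus ex1: "\<exists>!\<nu>. \<nu> > nu_tilde \<and> (1 - of_real \<alpha>) * bessel_J \<nu> 1 = bessel_J (\<nu> + 1) 1"
    using ex1_bessel_K_1_eq[of "1 / (1 - \<alpha>)"] assms by simp
  have *: "nu2 \<alpha> > nu_tilde \<and> (1 - of_real \<alpha>) * bessel_J (nu2 \<alpha>) 1 = bessel_J (nu2 \<alpha> + 1) 1"
    unfolding nu2_def by (rule theI'[OF ex1])
  thus "nu2 \<alpha> > nu_tilde" "(1 - of_real \<alpha>) * bessel_J (nu2 \<alpha>) 1 = bessel_J (nu2 \<alpha> + 1) 1" by auto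
  thus "bessel_K (nu2 \<alpha>) 1 = 1 / (1 - \<alpha>)"
    using bessel_J_1_equation_iff[of "nu2 \<alpha>" \<alpha>] nu_tilde_eqs(1) assms by auto
qed

lemma starlike_of_order_bessel_g_iff_nu2:
  assumes "\<nu> > -1" "\<alpha> < 1"
  shows "starlike_of_order \<alpha> (bessel_g \<nu>) \<longleftrightarrow> \<nu> \<ge> nu2 \<alpha>"
  using starlike_of_order_bessel_g_iff[OF assms] nu2_K[OF assms(2)] nu2_gt[OF assms(2)]
    nu_tilde_eqs(1) bessel_K_1_le_iff[of "nu2 \<alpha>" \<nu>] assms(1) by simp

theorem theorem2:
  fixes \<alpha> :: real
  assumes "0 \<le> \<alpha>" and "\<alpha> < 1"
  shows "(\<exists>!\<nu>. \<nu> > -1 \<and> first_positive_zero_J \<nu> 1) \<and>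
         - 0.7746 < nu_tilde \<and> nu_tilde \<le> - 0.7745 \<and>
         (\<exists>!\<nu>. \<nu> > nu_tilde \<and> (1 - of_real \<alpha>) * bessel_J \<nu> 1 = bessel_J (\<nu> + 1) 1) \<and>
         (\<forall>\<nu>>-1. starlike_of_order \<alpha> (bessel_g \<nu>) \<longleftrightarrow> \<nu> \<ge> nu2 \<alpha>) \<and>
         (\<exists>!\<nu>. \<nu> > nu_tilde \<and> bessel_J \<nu> 1 = bessel_J (\<nu> + 1) 1) \<and>
         nu2 0 > nu_tilde \<and> bessel_J (nu2 0) 1 = bessel_J (nu2 0 + 1) 1 \<and>
         \<bar>nu2 0 - (- 0.3397)\<bar> < 0.0005 \<and>
         (\<forall>\<nu>>-1. starlike_on_disk (bessel_g \<nu>) \<longleftrightarrow> \<nu> \<ge> nu2 0)"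
proof -
  have tilde: "- 0.7746 < nu_tilde" "nu_tilde \<le> - 0.7745"
    using bessel_K_1_le_iff[of nu_tilde "- 0.7746"] bessel_K_1_le_iff[of nu_tilde "- 0.7745"]
      bessel_K_numeric(1,2) nu_tilde_eqs by auto
  have "- 0.3402 < nu2 0" "nu2 0 < - 0.3392"
    using bessel_K_1_le_iff[of "nu2 0" "- 0.3402"] bessel_K_1_le_iff[of "- 0.3392" "nu2 0"]
      bessel_K_numeric(3,4) nu2_K[of 0] nu2_gt[of 0] nu_tilde_eqs(1) by auto
  hence "\<bar>nu2 0 - (- 0.3397)\<bar> < 0.0005" unfolding abs_less_iff by simp
  moreover have "\<exists>!\<nu>. \<nu> > nu_tilde \<and> bessel_J \<nu> 1 = bessel_J (\<nu> + 1) 1"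
    using ex1_nu2[of 0] by simp
  moreover have "bessel_J (nu2 0) 1 = bessel_J (nu2 0 + 1) 1"
    using nu2_J[of 0] by simp
  ultimately show ?thesis
    using tilde ex1_first_positive_zero_J ex1_nu2[OF assms(2)] nu2_gt[of 0]
      starlike_of_order_bessel_g_iff_nu2[OF _ assms(2)] starlike_of_order_bessel_g_iff_nu2[of _ 0]
    by simp
qed

end
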